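(* For every constant $d$, the payoff query complexity of finding a Nash equilibrium of degree-$d$ graphical games is polynomial: there is a polynomial $P_d$ such that for all $n$ and $k$, the payoff query complexity of finding an exact (mixed) Nash equilibrium of $n$-player degree-$d$ graphical games in which every player has $k$ pure strategies is at most $P_d(n,k)$.
   Context: In an $n$-player degree-$d$ graphical game the players are the vertices of a graph of degree at most $d$, and each player's payoff is a function only of the pure strategies of himself and of his (at most $d$) neighbours. The underlying graph is not known to the querying algorithm; initially the algorithm knows only $n$, $k$ and $d$. A payoff query selects a pure-strategy profile $s$ and receives as response the payoffs that all players derive from $s$. The payoff query complexity of a class of games with respect to a solution concept is the smallest $N$ such that some (deterministic) algorithm finds a solution of every game in the class using at most $N$ payoff queries. Queries may be chosen adaptively, and no computational bound is imposed on the algorithm. *)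

theory Defs
  imports
    Complex_Main
    "HOL-Library.FuncSet"
    "HOL-Library.Extended_Real"
    "HOL-Computational_Algebra.Polynomial"
begin

(* Players are 0, ..., n-1 and each of them has the pure strategies 0, ..., k-1.
   A game assigns to a player and a pure profile a payoff; only its values on
   players below n and on profiles in "pure_profiles n k" are ever looked at. *)

type_synonym pure_profile = "nat \<Rightarrow> nat"
type_synonym mixed_profile = "nat \<Rightarrow> nat \<Rightarrow> real"
type_synonym game = "nat \<Rightarrow> pure_profile \<Rightarrow> real"

definition pure_profiles :: "nat \<Rightarrow> nat \<Rightarrow> pure_profile set" where
  "pure_profiles n k = {..<n} \<rightarrow>\<^sub>E {..<k}"

definition mixed_strategy :: "nat \<Rightarrow> (nat \<Rightarrow> real) \<Rightarrow> bool" where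
  "mixed_strategy k y \<longleftrightarrow> (\<forall>a<k. 0 \<le> y a) \<and> (\<Sum>a<k. y a) = 1"

definition expected_payoff :: "nat \<Rightarrow> nat \<Rightarrow> game \<Rightarrow> nat \<Rightarrow> mixed_profile \<Rightarrow> real" where
  "expected_payoff n k u i x = (\<Sum>s\<in>pure_profiles n k. (\<Prod>j<n. x j (s j)) * u i s)"

definition nash_equilibrium :: "nat \<Rightarrow> nat \<Rightarrow> game \<Rightarrow> mixed_profile \<Rightarrow> bool" where
  "nash_equilibrium n k u x \<longleftrightarrow>
     (\<forall>i<n. mixed_strategy k (x i)) \<and>
     (\<forall>i<n. \<forall>y. mixed_strategy k y \<longrightarrow>
        expected_payoff n k u i (x(i := y)) \<le> expected_payoff n k u i x)"

(* Simple undirected graphs on the players, given by a symmetric irreflexive adjacency relation. *)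
definition graph_of_degree :: "nat \<Rightarrow> nat \<Rightarrow> nat rel \<Rightarrow> bool" where
  "graph_of_degree n d E \<longleftrightarrow>
     E \<subseteq> {..<n} \<times> {..<n} \<and> sym E \<and> irrefl E \<and> (\<forall>i<n. card (E `` {i}) \<le> d)"

definition graphical_games :: "nat \<Rightarrow> nat \<Rightarrow> nat \<Rightarrow> game set" where
  "graphical_games n k d = {u. \<exists>E. graph_of_degree n d E \<and>
     (\<forall>i<n. \<forall>s\<in>pure_profiles n k. \<forall>t\<in>pure_profiles n k.
        (\<forall>j\<in>insert i (E `` {i}). s j = t j) \<longrightarrow> u i s = u i t)}"

(* A deterministic adaptive query algorithm is a decision tree: the continuation after a
   query may depend, without any computability restriction, on the payoff vector received. *)
datatype algorithm =
    Output mixed_profile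
  | Query pure_profile "(nat \<Rightarrow> real) \<Rightarrow> algorithm"

(* The restriction to players below n makes sure that the response contains nothing
   but the payoffs of the actual players. *)
definition response :: "nat \<Rightarrow> game \<Rightarrow> pure_profile \<Rightarrow> (nat \<Rightarrow> real)" where
  "response n u s = (\<lambda>i\<in>{..<n}. u i s)"

primrec queries :: "(pure_profile \<Rightarrow> (nat \<Rightarrow> real)) \<Rightarrow> algorithm \<Rightarrow> pure_profile list" where
  "queries r (Output x) = []"
| "queries r (Query s c) = s # queries r (c (r s))"

primrec result :: "(pure_profile \<Rightarrow> (nat \<Rightarrow> real)) \<Rightarrow> algorithm \<Rightarrow> mixed_profile" where
  "result r (Output x) = x"
| "result r (Query s c) = result r (c (r s))"

(* The algorithm may depend on n, k and the class of games, but not on the game u itself. *)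
definition solvable_with ::
  "nat \<Rightarrow> nat \<Rightarrow> game set \<Rightarrow> (game \<Rightarrow> mixed_profile \<Rightarrow> bool) \<Rightarrow> nat \<Rightarrow> bool" where
  "solvable_with n k G sol N \<longleftrightarrow>
     (\<exists>A. \<forall>u\<in>G.
        set (queries (response n u) A) \<subseteq> pure_profiles n k \<and>
        length (queries (response n u) A) \<le> N \<and>
        sol u (result (response n u) A))"

(* The infimum is the least such N, and infinity if there is none. *)
definition payoff_query_complexity ::
  "nat \<Rightarrow> nat \<Rightarrow> game set \<Rightarrow> (game \<Rightarrow> mixed_profile \<Rightarrow> bool) \<Rightarrow> enat" where
  "payoff_query_complexity n k G sol = (INF N\<in>{N. solvable_with n k G sol N}. enat N)"

(* The value at (x, y) of a polynomial in two variables, represented as a polynomial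
   in the first variable whose coefficients are polynomials in the second one. *)
definition poly2 :: "real poly poly \<Rightarrow> real \<Rightarrow> real \<Rightarrow> real" where
  "poly2 P x y = poly (poly P [:x:]) y"

end

theory Submission
  imports Defs "HOL-Analysis.Analysis"
begin

text \<open>Query every profile in which at most \<open>d + 1\<close> players deviate from the strategy \<open>0\<close>. As each
  payoff depends on at most \<open>d + 1\<close> players, two degree-\<open>d\<close> games with the same answers coincide,
  even if their graphs differ, so an equilibrium of any game consistent with the answers will do.
  That it exists is Nash's theorem; as the number of players is a variable and not a type,
  Brouwer's theorem is derived from Kuhn's lemma on cubes in \<open>nat \<Rightarrow> real\<close>.\<close>

section \<open>Brouwer's fixed point theorem on cubes of variable dimension\<close>

definition cube :: "nat \<Rightarrow> (nat \<Rightarrow> real) set" where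
  "cube m = (\<Pi>\<^sub>E i\<in>UNIV. if i < m then {0..1} else {0})"

lemma mem_cube_iff: "x \<in> cube m \<longleftrightarrow> (\<forall>i<m. 0 \<le> x i \<and> x i \<le> 1) \<and> (\<forall>i\<ge>m. x i = 0)"
proof -
  have "x \<in> cube m \<longleftrightarrow> (\<forall>i. x i \<in> (if i < m then {0..1} else {0}))"
    by (simp add: cube_def PiE_UNIV_domain Pi_iff)
  then show ?thesis by (metis atLeastAtMost_iff not_less singleton_iff)
qed

text \<open>Tychonoff's theorem applies because the coordinates from \<open>m\<close> on are pinned
  to \<open>0\<close>, which makes every factor of the infinite product compact.\<close>

lemma compact_cube: "compact (cube m)"
proof -
  have "compactin (product_topology (\<lambda>i::nat. euclidean :: real topology) UNIV) (cube m)"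
    unfolding cube_def compactin_PiE by auto
  then show ?thesis
    by (simp add: euclidean_product_topology)
qed

lemma tendsto_coordinatewise_iff:
  fixes f :: "'a \<Rightarrow> 'b \<Rightarrow> 'c::topological_space"
  shows "(f \<longlongrightarrow> l) F \<longleftrightarrow> (\<forall>i. ((\<lambda>x. f x i) \<longlongrightarrow> l i) F)"
  using limitin_componentwise[of "\<lambda>_. euclidean" "UNIV :: 'b set" f l F]
  by (simp add: euclidean_product_topology)

text \<open>The unit cube is cut into \<open>p ^ m\<close> subcubes, of which Kuhn's lemma selects one with corner \<open>y\<close>.\<close>

lemma sign_changes_in_small_cube:
  fixes f :: "(nat \<Rightarrow> real) \<Rightarrow> nat \<Rightarrow> real"
  assumes f01: "\<And>x i. x \<in> cube m \<Longrightarrow> i < m \<Longrightarrow> 0 \<le> f x i \<and> f x i \<le> 1" and "0 < p"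
  obtains y where "y \<in> cube m"
    and "\<forall>i<m. \<exists>v\<in>cube m. \<exists>w\<in>cube m.
      (\<forall>j. \<bar>v j - y j\<bar> \<le> 1 / real p \<and> \<bar>w j - y j\<bar> \<le> 1 / real p) \<and> v i \<le> f v i \<and> f w i \<le> w i"
proof -
  define pt where "pt x = (\<lambda>i. if i < m then real (x i) / real p else 0)" for x :: "nat \<Rightarrow> nat"
  \<comment> \<open>The label is \<open>0\<close> where \<open>f\<close> does not decrease
    coordinate \<open>i\<close> and \<open>1\<close> otherwise, except that Kuhn's lemma prescribes
    \<open>0\<close> on the face \<open>x i = 0\<close> and \<open>1\<close> on the face
    \<open>x i = p\<close>. Since the values of \<open>f\<close> lie between \<open>0\<close> and
    \<open>1\<close>, the prescribed labels still give the weak inequalities \<open>label0\<close>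
    and \<open>label1\<close>.\<close>
  define label where "label x i =
    (if x i = 0 \<or> x i \<noteq> p \<and> pt x i \<le> f (pt x) i then 0 else 1 :: nat)" for x i
  have pt_cube: "pt x \<in> cube m" if "\<forall>i<m. x i \<le> p" for x
    using that \<open>0 < p\<close> by (auto simp: mem_cube_iff pt_def)
  have label0: "pt x i \<le> f (pt x) i" if "\<forall>i<m. x i \<le> p" "i < m" "label x i = 0" for x i
    using that f01[OF pt_cube[OF that(1)] that(2)]
    by (auto simp: label_def pt_def split: if_splits)
  have label1: "f (pt x) i \<le> pt x i" if "\<forall>i<m. x i \<le> p" "i < m" "label x i \<noteq> 0" for x i
    using that f01[OF pt_cube[OF that(1)] that(2)] \<open>0 < p\<close>
    by (auto simp: label_def pt_def split: if_splits)
  obtain q where q: "\<forall>i<m. q i < p"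
    and rs: "\<forall>i<m. \<exists>r s. (\<forall>j<m. q j \<le> r j \<and> r j \<le> q j + 1) \<and>
      (\<forall>j<m. q j \<le> s j \<and> s j \<le> q j + 1) \<and> label r i \<noteq> label s i"
  proof (rule kuhn_lemma[of p m label])
    show "\<forall>x. (\<forall>i<m. x i \<le> p) \<longrightarrow> (\<forall>i<m. x i = p \<longrightarrow> label x i = 1)"
      using \<open>0 < p\<close> by (auto simp: label_def)
  qed (use \<open>0 < p\<close> in \<open>auto simp: label_def\<close>)
  have close: "(\<forall>i<m. r i \<le> p) \<and> (\<forall>j. \<bar>pt r j - pt q j\<bar> \<le> 1 / real p)"
    if "\<forall>j<m. q j \<le> r j \<and> r j \<le> q j + 1" for r
  proof (intro conjI allI impI)
    show "r i \<le> p" if "i < m" for i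
      using that \<open>\<forall>j<m. q j \<le> r j \<and> r j \<le> q j + 1\<close> q by (metis Suc_eq_plus1 Suc_leI order_trans)
    show "\<bar>pt r j - pt q j\<bar> \<le> 1 / real p" for j
    proof (cases "j < m")
      case True
      then have "\<bar>real (r j) - real (q j)\<bar> \<le> 1" using that by fastforce
      then show ?thesis
        using True \<open>0 < p\<close> by (simp add: pt_def flip: diff_divide_distrib) (simp add: divide_right_mono)
    qed (simp add: pt_def)
  qed
  show ?thesis
  proof (rule that)
    show "pt q \<in> cube m" using q by (intro pt_cube) (simp add: less_imp_le)
    show "\<forall>i<m. \<exists>v\<in>cube m. \<exists>w\<in>cube m.
      (\<forall>j. \<bar>v j - pt q j\<bar> \<le> 1 / real p \<and> \<bar>w j - pt q j\<bar> \<le> 1 / real p) \<and> v i \<le> f v i \<and> f w i \<le> w i"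
    proof (intro allI impI)
      fix i assume "i < m"
      with rs obtain r s where rs: "\<forall>j<m. q j \<le> r j \<and> r j \<le> q j + 1"
          "\<forall>j<m. q j \<le> s j \<and> s j \<le> q j + 1" and neq: "label r i \<noteq> label s i"
        by blast
      \<comment> \<open>Kuhn's lemma says that two labels differ, but not which of the two vertices
        is labelled \<open>0\<close>; the claim for arbitrary \<open>a\<close> and \<open>b\<close>
        serves both orders.\<close>
      have witness: "\<exists>v\<in>cube m. \<exists>w\<in>cube m.
        (\<forall>j. \<bar>v j - pt q j\<bar> \<le> 1 / real p \<and> \<bar>w j - pt q j\<bar> \<le> 1 / real p) \<and> v i \<le> f v i \<and> f w i \<le> w i"
        if a: "\<forall>j<m. q j \<le> a j \<and> a j \<le> q j + 1" and b: "\<forall>j<m. q j \<le> b j \<and> b j \<le> q j + 1"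
          and "label a i = 0" "label b i \<noteq> 0" for a b
        by (rule bexI[of _ "pt a"], rule bexI[of _ "pt b"])
          (use that close[OF a] close[OF b] pt_cube label0 label1 \<open>i < m\<close> in auto)
      show "\<exists>v\<in>cube m. \<exists>w\<in>cube m.
        (\<forall>j. \<bar>v j - pt q j\<bar> \<le> 1 / real p \<and> \<bar>w j - pt q j\<bar> \<le> 1 / real p) \<and> v i \<le> f v i \<and> f w i \<le> w i"
      proof (cases "label r i = 0")
        case True
        with neq rs show ?thesis by (intro witness) auto
      next
        case False
        then have "label s i = 0" using neq by (auto simp: label_def split: if_splits)
        with False rs show ?thesis by (intro witness) auto
      qed
    qed
  qed
qed

text \<open>As the mesh tends to \<open>0\<close>, compactness yields a subsequence of the corners
  with a limit \<open>x\<close>. For every coordinate the witnesses of both inequalities converge to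
  this same \<open>x\<close>, where continuity turns the opposite inequalities into an
  equality.\<close>

lemma brouwer_nat_cube:
  fixes f :: "(nat \<Rightarrow> real) \<Rightarrow> nat \<Rightarrow> real"
  assumes f01: "\<And>x i. x \<in> cube m \<Longrightarrow> i < m \<Longrightarrow> 0 \<le> f x i \<and> f x i \<le> 1"
    and cont: "\<And>i. i < m \<Longrightarrow> continuous_on (cube m) (\<lambda>x. f x i)"
  obtains x where "x \<in> cube m" "\<And>i. i < m \<Longrightarrow> f x i = x i"
proof -
  have "\<exists>y. y \<in> cube m \<and> (\<forall>i<m. \<exists>v\<in>cube m. \<exists>w\<in>cube m.
      (\<forall>j. \<bar>v j - y j\<bar> \<le> 1 / real (Suc p) \<and> \<bar>w j - y j\<bar> \<le> 1 / real (Suc p)) \<and>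
      v i \<le> f v i \<and> f w i \<le> w i)" for p
    using sign_changes_in_small_cube[of m f "Suc p"] f01 by (metis zero_less_Suc)
  then obtain y where y: "\<And>p. y p \<in> cube m"
    and "\<forall>p. \<forall>i<m. \<exists>v\<in>cube m. \<exists>w\<in>cube m.
      (\<forall>j. \<bar>v j - y p j\<bar> \<le> 1 / real (Suc p) \<and> \<bar>w j - y p j\<bar> \<le> 1 / real (Suc p)) \<and>
      v i \<le> f v i \<and> f w i \<le> w i"
    by metis
  \<comment> \<open>The guard \<open>i < m\<close> moves inside the existential quantifiers, so that
    choice gives total functions of \<open>p\<close> and \<open>i\<close>.\<close>
  then have "\<forall>p i. \<exists>v w. i < m \<longrightarrow> v \<in> cube m \<and> w \<in> cube m \<and>
      (\<forall>j. \<bar>v j - y p j\<bar> \<le> 1 / real (Suc p)) \<and> (\<forall>j. \<bar>w j - y p j\<bar> \<le> 1 / real (Suc p)) \<and>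
      v i \<le> f v i \<and> f w i \<le> w i"
    by meson
  then obtain v w where "\<forall>p i. i < m \<longrightarrow> v p i \<in> cube m \<and> w p i \<in> cube m \<and>
      (\<forall>j. \<bar>v p i j - y p j\<bar> \<le> 1 / real (Suc p)) \<and> (\<forall>j. \<bar>w p i j - y p j\<bar> \<le> 1 / real (Suc p)) \<and>
      v p i i \<le> f (v p i) i \<and> f (w p i) i \<le> w p i i"
    by metis
  then have v: "\<And>p i. i < m \<Longrightarrow> v p i \<in> cube m" and w: "\<And>p i. i < m \<Longrightarrow> w p i \<in> cube m"
    and vy: "\<And>p i j. i < m \<Longrightarrow> \<bar>v p i j - y p j\<bar> \<le> 1 / real (Suc p)"
    and wy: "\<And>p i j. i < m \<Longrightarrow> \<bar>w p i j - y p j\<bar> \<le> 1 / real (Suc p)"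
    and fv: "\<And>p i. i < m \<Longrightarrow> v p i i \<le> f (v p i) i"
    and fw: "\<And>p i. i < m \<Longrightarrow> f (w p i) i \<le> w p i i"
    by blast+
  from compact_imp_seq_compact[OF compact_cube] y obtain x \<phi>
    where x: "x \<in> cube m" and \<phi>: "strict_mono \<phi>" and lim: "(y \<circ> \<phi>) \<longlonglongrightarrow> x"
    unfolding seq_compact_def by blast
  \<comment> \<open>One statement about any sequence that stays within the mesh of the corners
    covers both families of witnesses.\<close>
  have lim': "(\<lambda>p. u (\<phi> p)) \<longlonglongrightarrow> x" if "\<And>p j. \<bar>u p j - y p j\<bar> \<le> 1 / real (Suc p)" for u
    unfolding tendsto_coordinatewise_iff
  proof
    fix j
    have "(\<lambda>p. u p j - y p j) \<longlonglongrightarrow> 0"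
      by (rule tendsto_0_le[OF LIMSEQ_inverse_real_of_nat, where K = 1])
        (use that in \<open>auto simp: inverse_eq_divide\<close>)
    then have "(\<lambda>p. u (\<phi> p) j - y (\<phi> p) j) \<longlonglongrightarrow> 0"
      using LIMSEQ_subseq_LIMSEQ[OF _ \<phi>] by (simp add: o_def)
    moreover have "(\<lambda>p. y (\<phi> p) j) \<longlonglongrightarrow> x j"
      using lim unfolding tendsto_coordinatewise_iff by (simp add: o_def)
    ultimately have "(\<lambda>p. (u (\<phi> p) j - y (\<phi> p) j) + y (\<phi> p) j) \<longlonglongrightarrow> 0 + x j"
      by (rule tendsto_add)
    then show "(\<lambda>p. u (\<phi> p) j) \<longlonglongrightarrow> x j" by simp
  qed
  have "f x i = x i" if "i < m" for i
  proof (rule antisym)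
    have f_lim: "(\<lambda>p. f (u p) i) \<longlonglongrightarrow> f x i" if "u \<longlonglongrightarrow> x" "\<And>p. u p \<in> cube m" for u
      by (rule continuous_on_tendsto_compose[OF cont[OF \<open>i < m\<close>] that(1) x]) (simp add: that(2))
    have vl: "(\<lambda>p. v (\<phi> p) i) \<longlonglongrightarrow> x" and wl: "(\<lambda>p. w (\<phi> p) i) \<longlonglongrightarrow> x"
      using lim'[of "\<lambda>p. v p i"] lim'[of "\<lambda>p. w p i"] vy wy \<open>i < m\<close> by auto
    show "x i \<le> f x i"
      by (rule LIMSEQ_le[OF vl[unfolded tendsto_coordinatewise_iff, rule_format] f_lim[OF vl]])
        (use v fv \<open>i < m\<close> in auto)
    show "f x i \<le> x i"
      by (rule LIMSEQ_le[OF f_lim[OF wl] wl[unfolded tendsto_coordinatewise_iff, rule_format]])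
        (use w fw \<open>i < m\<close> in auto)
  qed
  with x show ?thesis by (rule that)
qed

section \<open>Existence of mixed Nash equilibria\<close>

definition pure :: "nat \<Rightarrow> nat \<Rightarrow> real" where
  "pure a = (\<lambda>b. if b = a then 1 else 0)"

text \<open>A player's own strategy enters each product of probabilities as a single factor, so the
  expected payoff is linear in it. Hence only pure deviations have to be examined.\<close>

lemma expected_payoff_deviation:
  assumes "i < n"
  shows "expected_payoff n k u i (x(i := y)) =
    (\<Sum>a<k. y a * expected_payoff n k u i (x(i := pure a)))"
proof -
  have prod_upd: "(\<Prod>j<n. (x(i := z)) j (s j)) = z (s i) * (\<Prod>j\<in>{..<n} - {i}. x j (s j))"
    for z and s :: pure_profile
    using assms by (subst prod.remove[of _ i]) (auto intro!: prod.cong)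
  have "(\<Prod>j<n. (x(i := y)) j (s j)) * u i s =
      (\<Sum>a<k. y a * ((\<Prod>j<n. (x(i := pure a)) j (s j)) * u i s))"
    if "s \<in> pure_profiles n k" for s
  proof -
    have "s i < k" using that assms by (auto simp: pure_profiles_def)
    then have "y (s i) = (\<Sum>a<k. y a * pure a (s i))"
      by (simp add: pure_def if_distrib cong: if_cong)
    then show ?thesis
      by (simp only: prod_upd) (simp add: sum_distrib_right sum_distrib_left mult_ac)
  qed
  then show ?thesis
    unfolding expected_payoff_def sum_distrib_left
    by (subst sum.swap) (rule sum.cong, auto)
qed

text \<open>Nash's map, precomposed with a retraction of the cube onto the product of simplices.\<close>

theorem nash_equilibrium_exists:
  assumes "k \<ge> 1"
  shows "\<exists>x. nash_equilibrium n k u x"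
proof -
  \<comment> \<open>Coordinate \<open>i * k + a\<close> of a point of the cube is the weight that
    player \<open>i\<close> puts on strategy \<open>a\<close>.\<close>
  define S where "S z i = (\<Sum>a<k. z (i * k + a))" for z :: "nat \<Rightarrow> real" and i
  \<comment> \<open>This is the retraction: a total weight below \<open>1\<close> is filled up by
    spreading the deficit evenly over the \<open>k\<close> strategies, a total above
    \<open>1\<close> is scaled down, and a total of \<open>1\<close> is left alone.\<close>
  define X where "X z i a = (z (i * k + a) + max 0 (1 - S z i) / k) / max 1 (S z i)" for z i a
  define g where "g z i a = max 0 (expected_payoff n k u i ((X z)(i := pure a)) -
    expected_payoff n k u i (X z))" for z i a
  define F where "F z m = (X z (m div k) (m mod k) + g z (m div k) (m mod k)) /
    (1 + (\<Sum>a<k. g z (m div k) a))" for z m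
  have index: "i * k + a < n * k" if "i < n" "a < k" for i a
  proof -
    have "i * k + a < Suc i * k" using that by simp
    also have "\<dots> \<le> n * k" using that by (intro mult_right_mono) auto
    finally show ?thesis .
  qed
  have g_nonneg: "0 \<le> g z i a" for z i a by (simp add: g_def)
  have denom_pos: "0 < 1 + (\<Sum>a<k. g z i a)" for z i
    by (intro add_pos_nonneg sum_nonneg g_nonneg) simp
  have mixed_X: "mixed_strategy k (X z i)" if "z \<in> cube (n * k)" "i < n" for z i
  proof -
    have "0 \<le> X z i a" if "a < k" for a
      using \<open>z \<in> _\<close> index[OF \<open>i < n\<close> that] by (simp add: X_def mem_cube_iff)
    moreover have "(\<Sum>a<k. X z i a) = (S z i + max 0 (1 - S z i)) / max 1 (S z i)"
      using assms by (simp add: X_def S_def sum.distrib flip: sum_divide_distrib)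
    then have "(\<Sum>a<k. X z i a) = 1" by (simp add: max_def)
    ultimately show ?thesis by (simp add: mixed_strategy_def)
  qed
  have X_le_1: "X z i a \<le> 1" if "z \<in> cube (n * k)" "i < n" "a < k" for z i a
    using mixed_X[OF that(1,2)] member_le_sum[of a "{..<k}" "X z i"] that(3)
    by (auto simp: mixed_strategy_def)
  have F01: "0 \<le> F z m \<and> F z m \<le> 1" if "z \<in> cube (n * k)" "m < n * k" for z m
  proof -
    have i: "m div k < n" and a: "m mod k < k"
      using that assms by (auto simp: less_mult_imp_div_less)
    have "0 \<le> X z (m div k) (m mod k)"
      using mixed_X[OF that(1) i] a by (simp add: mixed_strategy_def)
    moreover have "g z (m div k) (m mod k) \<le> (\<Sum>b<k. g z (m div k) b)"
      using a by (intro member_le_sum) (auto simp: g_nonneg)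
    ultimately show ?thesis
      using X_le_1[OF that(1) i a] g_nonneg[of z "m div k" "m mod k"] denom_pos[of z "m div k"]
      by (auto simp: F_def)
  qed
  have cont_X: "continuous_on A (\<lambda>z. X z i a)" for A i a
    unfolding X_def S_def by (intro continuous_intros continuous_on_product_coordinates
      continuous_on_subset[OF continuous_on_product_coordinates]) (use assms in \<open>auto simp: max_def\<close>)
  have cont_upd: "continuous_on A (\<lambda>z. ((X z)(i := pure a)) j b)" for A i a j b
    by (cases "j = i") (simp_all add: cont_X)
  have cont_g: "continuous_on A (\<lambda>z. g z i a)" for A i a
    unfolding g_def expected_payoff_def by (intro continuous_intros cont_X cont_upd)
  have cont_F: "continuous_on A (\<lambda>z. F z m)" for A m
    unfolding F_def using denom_pos
    by (intro continuous_intros cont_X cont_g) (metis less_irrefl)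
  obtain z where z: "z \<in> cube (n * k)" and fixp: "\<And>m. m < n * k \<Longrightarrow> F z m = z m"
    using brouwer_nat_cube[of "n * k" F] F01 cont_F by blast
  have fixp': "z (i * k + a) = (X z i a + g z i a) / (1 + (\<Sum>b<k. g z i b))"
    if "i < n" "a < k" for i a
    using fixp[OF index[OF that]] that by (simp add: F_def)
  \<comment> \<open>Every block of a value of \<open>F\<close> sums to \<open>1\<close>, so the
    fixed point already lies in the product of simplices, where the retraction is the
    identity.\<close>
  have S1: "S z i = 1" if "i < n" for i
  proof -
    have "S z i = (\<Sum>a<k. (X z i a + g z i a) / (1 + (\<Sum>b<k. g z i b)))"
      unfolding S_def using fixp'[OF that] by (intro sum.cong) auto
    also have "\<dots> = ((\<Sum>a<k. X z i a) + (\<Sum>a<k. g z i a)) / (1 + (\<Sum>b<k. g z i b))"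
      by (simp add: sum.distrib flip: sum_divide_distrib)
    also have "\<dots> = 1"
      using mixed_X[OF z that] denom_pos[of z i] by (simp add: mixed_strategy_def)
    finally show ?thesis .
  qed
  have X_fix: "X z i a * (\<Sum>b<k. g z i b) = g z i a" if "i < n" "a < k" for i a
    using fixp'[OF that] denom_pos[of z i] S1[OF that(1)]
    by (simp add: X_def[of z i a] field_simps)
  have no_gain: "expected_payoff n k u i ((X z)(i := pure a)) \<le> expected_payoff n k u i (X z)"
    if "i < n" "a < k" for i a
  proof -
    let ?v = "expected_payoff n k u i (X z)"
      and ?p = "\<lambda>a. expected_payoff n k u i ((X z)(i := pure a))"
    have mixed: "\<And>a. a < k \<Longrightarrow> 0 \<le> X z i a" "(\<Sum>a<k. X z i a) = 1"
      using mixed_X[OF z \<open>i < n\<close>] by (auto simp: mixed_strategy_def)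
    have v_eq: "?v = (\<Sum>a<k. X z i a * ?p a)"
      using expected_payoff_deviation[OF \<open>i < n\<close>, of k u "X z" "X z i"] by simp
    have "(\<Sum>a<k. X z i a * (?p a - ?v)) = (\<Sum>a<k. X z i a * ?p a) - (\<Sum>a<k. X z i a) * ?v"
      by (simp add: right_diff_distrib sum_subtractf sum_distrib_right)
    then have sum0: "(\<Sum>a<k. X z i a * (?p a - ?v)) = 0"
      by (simp only: mixed(2) v_eq[symmetric])
    \<comment> \<open>The payoff of a mixed strategy is a weighted average, so the strategies of
      positive weight cannot all earn more than it.\<close>
    have "\<exists>a<k. 0 < X z i a \<and> ?p a \<le> ?v"
    proof (rule ccontr)
      assume *: "\<not> (\<exists>a<k. 0 < X z i a \<and> ?p a \<le> ?v)"
      have "\<exists>a<k. X z i a \<noteq> 0"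
        using mixed(2) by (metis lessThan_iff sum.neutral zero_neq_one)
      then obtain a where a: "a < k" "0 < X z i a" using mixed(1) by (metis less_eq_real_def)
      have "0 < (\<Sum>a<k. X z i a * (?p a - ?v))"
      proof (rule sum_pos2[of _ a])
        show "0 < X z i a * (?p a - ?v)" using a * by (intro mult_pos_pos) force+
        show "0 \<le> X z i b * (?p b - ?v)" if "b \<in> {..<k}" for b
        proof (cases "X z i b = 0")
          case False
          then have "0 < X z i b" using mixed(1) that by (metis lessThan_iff less_eq_real_def)
          then have "?v < ?p b" using * that by force
          with \<open>0 < X z i b\<close> show ?thesis by simp
        qed simp
      qed (use a in auto)
      with sum0 show False by simp
    qed
    then obtain b where b: "b < k" "0 < X z i b" "?p b \<le> ?v" by blast
    \<comment> \<open>As \<open>b\<close> has positive weight but no gain, \<open>X_fix\<close>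
      forces the total gain of player \<open>i\<close> to vanish, and with it every single
      gain.\<close>
    then have "g z i b = 0" by (simp add: g_def)
    with X_fix[OF \<open>i < n\<close> b(1)] b(2) have "(\<Sum>a<k. g z i a) = 0" by simp
    then have "g z i a = 0"
      using \<open>a < k\<close> g_nonneg by (subst (asm) sum_nonneg_eq_0_iff) auto
    then show ?thesis by (simp add: g_def max_def split: if_splits)
  qed
  have "nash_equilibrium n k u (X z)"
    unfolding nash_equilibrium_def
  proof (intro conjI allI impI)
    fix i y assume i: "i < n" and y: "mixed_strategy k y"
    have "expected_payoff n k u i ((X z)(i := y)) =
        (\<Sum>a<k. y a * expected_payoff n k u i ((X z)(i := pure a)))"
      by (rule expected_payoff_deviation[OF i])
    also have "\<dots> \<le> (\<Sum>a<k. y a * expected_payoff n k u i (X z))"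
      using y no_gain[OF i] by (intro sum_mono mult_left_mono) (auto simp: mixed_strategy_def)
    also have "\<dots> = expected_payoff n k u i (X z)"
      using y by (simp add: mixed_strategy_def flip: sum_distrib_right)
    finally show "expected_payoff n k u i ((X z)(i := y)) \<le> expected_payoff n k u i (X z)" .
  qed (use mixed_X z in blast)
  then show ?thesis by blast
qed

text \<open>This carries an equilibrium of a game consistent with the answers over to the game that
  was queried.\<close>

lemma nash_equilibrium_cong:
  assumes "\<And>i s. i < n \<Longrightarrow> s \<in> pure_profiles n k \<Longrightarrow> u i s = v i s"
  shows "nash_equilibrium n k u x \<longleftrightarrow> nash_equilibrium n k v x"
proof -
  have "expected_payoff n k u i y = expected_payoff n k v i y" if "i < n" for i y
    unfolding expected_payoff_def using assms that by (intro sum.cong) auto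
  then show ?thesis by (simp add: nash_equilibrium_def)
qed

section \<open>Payoffs determined by profiles with few deviating players\<close>

definition deviation :: "nat \<Rightarrow> nat set \<Rightarrow> pure_profile \<Rightarrow> pure_profile" where
  "deviation n M s = (\<lambda>i\<in>{..<n}. if i \<in> M then s i else 0)"

definition sparse_profiles :: "nat \<Rightarrow> nat \<Rightarrow> nat \<Rightarrow> pure_profile set" where
  "sparse_profiles n k m =
     {deviation n M s | M s. M \<subseteq> {..<n} \<and> card M \<le> m \<and> s \<in> pure_profiles n k}"

lemma deviation_in_pure_profiles:
  "k \<ge> 1 \<Longrightarrow> s \<in> pure_profiles n k \<Longrightarrow> deviation n M s \<in> pure_profiles n k"
  by (simp add: deviation_def pure_profiles_def PiE_iff)

text \<open>This combines restrictions to neighbourhoods taken from two different graphs.\<close>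

lemma deviation_deviation: "deviation n M (deviation n M' s) = deviation n (M \<inter> M') s"
  by (rule ext) (simp add: deviation_def)

lemma sparse_profiles_subset: "k \<ge> 1 \<Longrightarrow> sparse_profiles n k m \<subseteq> pure_profiles n k"
  unfolding sparse_profiles_def using deviation_in_pure_profiles by blast

text \<open>A profile with at most \<open>m\<close> deviating players is coded by exactly \<open>m\<close> pairs
  (player, strategy), where the non-existent player \<open>n\<close> serves for padding.\<close>

lemma sparse_profiles_bound:
  assumes "k \<ge> 1"
  shows "finite (sparse_profiles n k m) \<and> card (sparse_profiles n k m) \<le> ((n + 1) * k) ^ m"
proof -
  define L where "L = {xs. set xs \<subseteq> {..n} \<times> {..<k} \<and> length xs = m}"
  \<comment> \<open>Players missing from the list fall back to strategy \<open>0\<close>. Only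
    players below \<open>n\<close> are decoded, so the padding key \<open>n\<close> is never looked
    up.\<close>
  define dec where "dec xs = (\<lambda>i\<in>{..<n}. case map_of xs i of None \<Rightarrow> 0 | Some a \<Rightarrow> a)"
    for xs :: "(nat \<times> nat) list"
  have "sparse_profiles n k m \<subseteq> dec ` L"
  proof
    fix t assume "t \<in> sparse_profiles n k m"
    then obtain M s where M: "M \<subseteq> {..<n}" "card M \<le> m" and s: "s \<in> pure_profiles n k"
      and t: "t = deviation n M s"
      by (auto simp: sparse_profiles_def)
    have "finite M" using M(1) finite_subset by blast
    define xs where "xs = map (\<lambda>i. (i, s i)) (sorted_list_of_set M) @ replicate (m - card M) (n, 0)"
    have "xs \<in> L"
      using M \<open>finite M\<close> s assms by (auto simp: L_def xs_def pure_profiles_def set_replicate_conv_if)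
    moreover have "map_of (replicate j (n, 0 :: nat)) i = None" if "i < n" for i j
      using that by (induction j) auto
    then have "dec xs = t"
      using \<open>finite M\<close>
      unfolding dec_def t deviation_def
      by (intro restrict_ext) (auto simp: xs_def map_add_def map_of_map_restrict restrict_map_def
          split: option.splits)
    ultimately show "t \<in> dec ` L" by blast
  qed
  moreover have "finite L" "card L = ((n + 1) * k) ^ m"
    unfolding L_def by (simp_all add: finite_lists_length_eq card_lists_length_eq)
  ultimately show ?thesis
    by (metis card_image_le card_mono finite_imageI finite_subset order_trans)
qed

text \<open>If \<open>N\<close> and \<open>N'\<close> are closed neighbourhoods of player \<open>i\<close> for \<open>u\<close> and \<open>v\<close>, then both payoffs
  at \<open>s\<close> equal the payoff at the restriction of \<open>s\<close> to \<open>N \<inter> N'\<close>.\<close>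

lemma graphical_game_determined:
  assumes u: "u \<in> graphical_games n k d" and v: "v \<in> graphical_games n k d"
    and agree: "\<And>i t. i < n \<Longrightarrow> t \<in> sparse_profiles n k (d + 1) \<Longrightarrow> u i t = v i t"
    and "k \<ge> 1" "i < n" and s: "s \<in> pure_profiles n k"
  shows "u i s = v i s"
proof -
  \<comment> \<open>The set \<open>N\<close> contains player \<open>i\<close> besides the
    neighbours, hence the bound \<open>d + 1\<close>; resetting everybody else to \<open>0\<close>
    does not affect the payoff of \<open>i\<close>.\<close>
  have local: "\<exists>N \<subseteq> {..<n}. card N \<le> d + 1 \<and>
      (\<forall>s\<in>pure_profiles n k. w i s = w i (deviation n N s))"
    if w0: "w \<in> graphical_games n k d" for w
  proof -
    obtain E where E: "graph_of_degree n d E"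
      and w: "\<forall>s\<in>pure_profiles n k. \<forall>t\<in>pure_profiles n k.
        (\<forall>j\<in>insert i (E `` {i}). s j = t j) \<longrightarrow> w i s = w i t"
      using w0 \<open>i < n\<close> unfolding graphical_games_def by blast
    let ?N = "insert i (E `` {i})"
    have "?N \<subseteq> {..<n}" and deg: "card (E `` {i}) \<le> d"
      using E \<open>i < n\<close> by (auto simp: graph_of_degree_def)
    moreover have "card ?N \<le> d + 1"
      using deg by (metis Suc_eq_plus1 card_insert_le_m1 diff_Suc_1 zero_less_Suc)
    moreover have "w i s = w i (deviation n ?N s)" if "s \<in> pure_profiles n k" for s
      using that \<open>?N \<subseteq> {..<n}\<close>
      by (intro w[rule_format] deviation_in_pure_profiles \<open>k \<ge> 1\<close>) (auto simp: deviation_def)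
    ultimately show ?thesis by blast
  qed
  from local[OF u] obtain N where N: "N \<subseteq> {..<n}" "card N \<le> d + 1"
    and uN: "\<And>s. s \<in> pure_profiles n k \<Longrightarrow> u i s = u i (deviation n N s)" by blast
  from local[OF v] obtain N' where N': "N' \<subseteq> {..<n}" "card N' \<le> d + 1"
    and vN': "\<And>s. s \<in> pure_profiles n k \<Longrightarrow> v i s = v i (deviation n N' s)" by blast
  have agree': "u i (deviation n M s) = v i (deviation n M s)" if "M \<subseteq> {..<n}" "card M \<le> d + 1" for M
    using agree[OF \<open>i < n\<close>] that s by (auto simp: sparse_profiles_def)
  have dev: "deviation n M s \<in> pure_profiles n k" for M
    using deviation_in_pure_profiles[OF \<open>k \<ge> 1\<close> s] .
  have "u i s = v i (deviation n N s)"
    using uN[OF s] agree'[OF N] by simp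
  also have "\<dots> = v i (deviation n (N \<inter> N') s)"
    using vN'[OF dev] by (simp add: deviation_deviation Int_commute[of N])
  also have "\<dots> = u i (deviation n (N \<inter> N') s)"
  proof (rule agree'[symmetric])
    have "card (N \<inter> N') \<le> card N"
      using N(1) by (intro card_mono finite_subset[OF N(1)]) auto
    then show "card (N \<inter> N') \<le> d + 1" using N(2) by simp
  qed (use N(1) in blast)
  also have "\<dots> = u i (deviation n N' s)"
    using uN[OF dev] by (simp add: deviation_deviation)
  also have "\<dots> = v i s"
    using vN'[OF s] agree'[OF N'] by simp
  finally show ?thesis .
qed

section \<open>The non-adaptive algorithm and its polynomial bound\<close>

primrec query_all ::
  "pure_profile list \<Rightarrow> ((pure_profile \<Rightarrow> nat \<Rightarrow> real) \<Rightarrow> mixed_profile) \<Rightarrow> algorithm" where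
  "query_all [] h = Output (h (\<lambda>_. undefined))"
| "query_all (s # qs) h = Query s (\<lambda>r. query_all qs (\<lambda>\<rho>. h (\<rho>(s := r))))"

lemma queries_query_all: "queries r (query_all qs h) = qs"
  by (induction qs arbitrary: h) auto

text \<open>The induction generalises \<open>h\<close>, because every query wraps it in one more
  update of the table of answers. A repeated query does no harm, as it stores the same answer
  again.\<close>

lemma result_query_all: "\<exists>\<rho>. (\<forall>s\<in>set qs. \<rho> s = r s) \<and> result r (query_all qs h) = h \<rho>"
proof (induction qs arbitrary: h)
  case (Cons s qs)
  from Cons.IH[of "\<lambda>\<rho>. h (\<rho>(s := r s))"] obtain \<rho>
    where "\<forall>t\<in>set qs. \<rho> t = r t" "result r (query_all (s # qs) h) = h (\<rho>(s := r s))"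
    by auto
  moreover from this have "\<forall>t\<in>set (s # qs). (\<rho>(s := r s)) t = r t" by simp
  ultimately show ?case by blast
qed auto

lemma graphical_games_solvable:
  assumes "k \<ge> 1"
  shows "solvable_with n k (graphical_games n k d) (nash_equilibrium n k) (((n + 1) * k) ^ (d + 1))"
proof -
  let ?Q = "sparse_profiles n k (d + 1)" and ?G = "graphical_games n k d"
  note bound = sparse_profiles_bound[OF assms, of n "d + 1"]
  then obtain qs where qs: "set qs = ?Q" "length qs = card ?Q"
    by (metis finite_distinct_list distinct_card)
  \<comment> \<open>The queried game itself meets this description, so the choice succeeds.
    Computation is free, so the game and its equilibrium may both be picked by
    \<open>SOME\<close>.\<close>
  define consistent where
    "consistent \<rho> = (SOME v. v \<in> ?G \<and> (\<forall>s\<in>?Q. \<rho> s = response n v s))" for \<rho>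
  define h where "h \<rho> = (SOME x. nash_equilibrium n k (consistent \<rho>) x)" for \<rho>
  have "nash_equilibrium n k u (result (response n u) (query_all qs h))" if u: "u \<in> ?G" for u
  proof -
    obtain \<rho> where \<rho>: "\<forall>s\<in>?Q. \<rho> s = response n u s"
      and res: "result (response n u) (query_all qs h) = h \<rho>"
      using result_query_all qs(1) by metis
    have cons: "consistent \<rho> \<in> ?G" "\<forall>s\<in>?Q. \<rho> s = response n (consistent \<rho>) s"
      unfolding consistent_def
      using someI[of "\<lambda>v. v \<in> ?G \<and> (\<forall>s\<in>?Q. \<rho> s = response n v s)" u] u \<rho> by auto
    have "u i s = consistent \<rho> i s" if "i < n" "s \<in> ?Q" for i s
    proof -
      have "response n u s i = response n (consistent \<rho>) s i" using cons(2) \<rho> that by metis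
      then show ?thesis using that by (simp add: response_def)
    qed
    then have "u i s = consistent \<rho> i s" if "i < n" "s \<in> pure_profiles n k" for i s
      using graphical_game_determined[OF u cons(1) _ assms] that by blast
    moreover have "nash_equilibrium n k (consistent \<rho>) (h \<rho>)"
      unfolding h_def by (rule someI_ex[OF nash_equilibrium_exists[OF assms]])
    ultimately show ?thesis
      unfolding res using nash_equilibrium_cong by metis
  qed
  then show ?thesis
    unfolding solvable_with_def
    using bound qs sparse_profiles_subset[OF assms] by (metis queries_query_all)
qed

text \<open>The degree \<open>d\<close> occurs only in the exponent of the query bound, which is
  therefore polynomial in \<open>n\<close> and \<open>k\<close>. For \<open>k = 0\<close> and
  \<open>n > 0\<close> there are no mixed strategies, hence no equilibria, and the complexity is
  infinite.\<close>

theorem theorem15: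
  fixes d :: nat
  shows "\<exists>P :: real poly poly. \<forall>n k :: nat. k \<ge> 1 \<longrightarrow>
    ereal_of_enat (payoff_query_complexity n k (graphical_games n k d) (nash_equilibrium n k))
      \<le> ereal (poly2 P (real n) (real k))"
\<comment> \<open>The outer variable stands for \<open>n\<close> and the inner one for
  \<open>k\<close>, so \<open>[:1, 1:]\<close> evaluates to \<open>n + 1\<close> and
  \<open>[:[:0, 1:]:]\<close> to \<open>k\<close>.\<close>
proof (intro exI[of _ "([:1, 1:] * [:[:0, 1:]:]) ^ (d + 1)"] allI impI)
  fix n k :: nat assume "k \<ge> 1"
  have "payoff_query_complexity n k (graphical_games n k d) (nash_equilibrium n k)
      \<le> enat (((n + 1) * k) ^ (d + 1))"
    unfolding payoff_query_complexity_def
    using graphical_games_solvable[OF \<open>k \<ge> 1\<close>] by (intro INF_lower) simp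
  then have "ereal_of_enat (payoff_query_complexity n k (graphical_games n k d) (nash_equilibrium n k))
      \<le> ereal_of_enat (enat (((n + 1) * k) ^ (d + 1)))"
    by (simp only: ereal_of_enat_le_iff)
  also have "\<dots> = ereal (poly2 (([:1, 1:] * [:[:0, 1:]:]) ^ (d + 1)) (real n) (real k))"
    by (simp add: poly2_def algebra_simps)
  finally show "ereal_of_enat (payoff_query_complexity n k (graphical_games n k d) (nash_equilibrium n k))
      \<le> ereal (poly2 (([:1, 1:] * [:[:0, 1:]:]) ^ (d + 1)) (real n) (real k))" .
qed

end
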